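(* Let $f:\mathbb{R}^{n\times n}\to\mathbb{R}$ be convex, differentiable, symmetric, $M$-smooth and $m$-strongly convex with $m>0$, and $\kappa=M/m$. Let $X^\star$ be the minimizer of $f$ over $\mathbb{S}^n_+$, $r\le\mathrm{rank}(X^\star)$, $X^\star_r$ its best rank-$r$ approximation, and $U^\star_r\in\mathbb{R}^{n\times r}$ with $X^\star_r=U^\star_r(U^\star_r)^\top$. Define $$X^0:=\frac{1}{\|\nabla f(0)-\nabla f(e_1e_1^\top)\|_F}\,\mathcal{P}_+\big(-\nabla f(0)\big),$$ let $X^0_r$ be its best rank-$r$ approximation and $U^0\in\mathbb{R}^{n\times r}$ with $U^0(U^0)^\top=X^0_r$. Suppose $\|X^\star-X^\star_r\|_F\le\tilde\rho\,\|X^\star_r\|_2$ for some $\tilde\rho\ge0$. Then $\mathrm{Dist}(U^0,U^\star_r)\le\gamma\,\sigma_r(U^\star_r)$, where $$\gamma=4\,\tau(X^\star_r)\sqrt{2r}\Big(\sqrt{\kappa^2-\tfrac{2}{\kappa}+1}\,\big(\mathrm{srank}(X^\star_r)^{1/2}+\tilde\rho\big)+\tilde\rho\Big),\qquad \mathrm{srank}(X^\star_r)=\frac{\|X^\star_r\|_F^2}{\|X^\star_r\|_2^2}.$$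
   Context: $\mathbb{S}^n_+$ is the cone of $n\times n$ positive semidefinite matrices; $\mathcal{P}_+(Y)$ is the projection of a symmetric matrix $Y$ onto $\mathbb{S}^n_+$, i.e. $\sum_{i:\lambda_i>0}\lambda_iv_iv_i^\top$ for an eigendecomposition $Y=\sum_i\lambda_iv_iv_i^\top$. $e_1$ is the first standard basis vector. For a matrix $A$, $\sigma_i(A)$ is its $i$-th largest singular value, $\|A\|_2=\sigma_1(A)$, $\|A\|_F$ the Frobenius norm, $\langle A,B\rangle=\mathrm{tr}(A^\top B)$. For a rank-$r$ PSD matrix $Z$, $\tau(Z)=\sigma_1(Z)/\sigma_r(Z)$. Best rank-$r$ approximations are by truncated eigenvalue decomposition. For $U,V\in\mathbb{R}^{n\times r}$, $\mathrm{Dist}(U,V)=\min_{R\in\mathcal{O}_r}\|U-VR\|_F$, $\mathcal{O}_r$ the $r\times r$ orthogonal matrices. $f$ symmetric means $f(X)=f(X^\top)$. $M$-smooth: $\|\nabla f(X)-\nabla f(Y)\|_F\le M\|X-Y\|_F$ for all $X,Y\in\mathbb{S}^n_+$. $m$-strongly convex: $f(Y)\ge f(X)+\langle\nabla f(X),Y-X\rangle+\frac m2\|Y-X\|_F^2$ for all $X,Y\in\mathbb{S}^n_+$. *)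

theory Defs
  imports "HOL-Analysis.Analysis"
begin

definition frob_inner :: "real^'c^'r \<Rightarrow> real^'c^'r \<Rightarrow> real" where
  "frob_inner A B = (\<Sum>i\<in>UNIV. \<Sum>j\<in>UNIV. A$i$j * B$i$j)"

definition frob_norm :: "real^'c^'r \<Rightarrow> real" where
  "frob_norm A = sqrt (\<Sum>i\<in>UNIV. \<Sum>j\<in>UNIV. (A$i$j)^2)"

definition outer :: "real^'n \<Rightarrow> real^'m \<Rightarrow> real^'m^'n" where
  "outer u w = (\<chi> i j. u$i * w$j)"

definition psd :: "real^'n^'n \<Rightarrow> bool" where
  "psd X \<longleftrightarrow> transpose X = X \<and> (\<forall>x. 0 \<le> x \<bullet> (X *v x))"

definition eig_decomp :: "real^'n^'n \<Rightarrow> (nat \<Rightarrow> real^'n) \<Rightarrow> (nat \<Rightarrow> real) \<Rightarrow> bool" where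
  "eig_decomp X v l \<longleftrightarrow>
     (\<forall>i<CARD('n). \<forall>j<CARD('n). v i \<bullet> v j = (if i = j then 1 else 0)) \<and>
     X = (\<Sum>i<CARD('n). l i *\<^sub>R outer (v i) (v i))"

definition desc_sorted :: "nat \<Rightarrow> (nat \<Rightarrow> real) \<Rightarrow> bool" where
  "desc_sorted n l \<longleftrightarrow> (\<forall>i j. i \<le> j \<longrightarrow> j < n \<longrightarrow> l j \<le> l i)"

text \<open>Eigenvalues in decreasing order (0-indexed), for symmetric matrices.\<close>
definition eigval_desc :: "real^'n^'n \<Rightarrow> nat \<Rightarrow> real" where
  "eigval_desc X = (SOME l. (\<exists>v. eig_decomp X v l) \<and> desc_sorted CARD('n) l)"

text \<open>i-th largest singular value (1-indexed), sigma_i(A) = sqrt(lambda_i(A^T A)).\<close>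
definition sing_val :: "real^'c^'r \<Rightarrow> nat \<Rightarrow> real" where
  "sing_val A i = sqrt (eigval_desc (transpose A ** A) (i - 1))"

definition spec_norm :: "real^'c^'r \<Rightarrow> real" where
  "spec_norm A = sing_val A 1"

definition tau :: "nat \<Rightarrow> real^'n^'n \<Rightarrow> real" where
  "tau r Z = sing_val Z 1 / sing_val Z r"

definition srank :: "real^'n^'n \<Rightarrow> real" where
  "srank Z = (frob_norm Z)^2 / (spec_norm Z)^2"

definition best_rank_approx :: "nat \<Rightarrow> real^'n^'n \<Rightarrow> real^'n^'n \<Rightarrow> bool" where
  "best_rank_approx r X Xr \<longleftrightarrow>
     (\<exists>v l. eig_decomp X v l \<and> desc_sorted CARD('n) l \<and>
        Xr = (\<Sum>i<r. l i *\<^sub>R outer (v i) (v i)))"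

definition psd_proj :: "real^'n^'n \<Rightarrow> real^'n^'n" where
  "psd_proj Y = (SOME P. \<exists>v l. eig_decomp Y v l \<and>
      P = (\<Sum>i\<in>{i. i < CARD('n) \<and> l i > 0}. l i *\<^sub>R outer (v i) (v i)))"

definition Dist :: "real^'r^'n \<Rightarrow> real^'r^'n \<Rightarrow> real" where
  "Dist U V = Inf {frob_norm (U - V ** R) | R. orthogonal_matrix R}"

definition e1 :: "real^'n::{finite,wellorder}" where
  "e1 = axis (LEAST i. True) 1"

end

theory Submission
  imports Defs
begin

text \<open>
  Let \<open>L = \<parallel>\<nabla>f(0) - \<nabla>f(e\<^sub>1e\<^sub>1\<^sup>T)\<parallel>\<close>; then \<open>m \<le> L \<le> M\<close>. First-order optimality of \<open>X\<^sup>\<star>\<close> on the cone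
  gives \<open>\<langle>\<nabla>f(X\<^sup>\<star>), X\<^sup>\<star>\<rangle> \<le> 0\<close> and \<open>\<langle>\<nabla>f(X\<^sup>\<star>), P\<rangle> \<ge> 0\<close> for \<open>P = \<P>\<^sub>+(-\<nabla>f(0))\<close>, from which
  \<open>\<parallel>P\<parallel> \<le> M\<parallel>X\<^sup>\<star>\<parallel>\<close> and \<open>\<langle>P, X\<^sup>\<star>\<rangle> \<ge> m\<parallel>X\<^sup>\<star>\<parallel>\<^sup>2\<close>; expanding the square yields
  \<open>\<parallel>X\<^sup>0 - X\<^sup>\<star>\<parallel>\<^sup>2 \<le> (\<kappa>\<^sup>2 - 2/\<kappa> + 1)\<parallel>X\<^sup>\<star>\<parallel>\<^sup>2\<close>. Truncation to rank \<open>r\<close> costs at most a factor 2 in the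
  distance to \<open>X\<^sup>\<star>\<^sub>r\<close> (Eckart--Young). Finally, if \<open>R\<close> is orthogonal and \<open>W = U\<^sup>\<star>\<^sub>rR\<close> makes \<open>W\<^sup>TU\<^sup>0\<close>
  positive semidefinite, then \<open>\<sigma>\<^sub>r(U\<^sup>\<star>\<^sub>r)\<parallel>U\<^sup>0 - W\<parallel> \<le> \<surd>2 \<parallel>X\<^sup>0\<^sub>r - X\<^sup>\<star>\<^sub>r\<parallel>\<close>.
\<close>

subsection \<open>Frobenius geometry of matrices\<close>

lemma frob_inner_eq_inner: "frob_inner A B = A \<bullet> B"
  by (simp add: frob_inner_def inner_vec_def)

lemma frob_norm_eq_norm: "frob_norm A = norm A"
  by (simp add: frob_norm_def norm_eq_sqrt_inner inner_vec_def power2_eq_square)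

lemma inner_matrix_mul_left:
  fixes A :: "real^'k^'m" and B :: "real^'n^'k" and C :: "real^'n^'m"
  shows "(A ** B) \<bullet> C = B \<bullet> (transpose A ** C)"
proof -
  have "(A ** B) \<bullet> C = (\<Sum>i\<in>UNIV. \<Sum>j\<in>UNIV. \<Sum>k\<in>UNIV. A$i$k * B$k$j * C$i$j)"
    by (simp add: inner_vec_def matrix_matrix_mult_def sum_distrib_right)
  also have "\<dots> = (\<Sum>i\<in>UNIV. \<Sum>k\<in>UNIV. \<Sum>j\<in>UNIV. A$i$k * B$k$j * C$i$j)"
    by (intro sum.cong refl sum.swap)
  also have "\<dots> = (\<Sum>k\<in>UNIV. \<Sum>i\<in>UNIV. \<Sum>j\<in>UNIV. A$i$k * B$k$j * C$i$j)"
    by (rule sum.swap)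
  also have "\<dots> = (\<Sum>k\<in>UNIV. \<Sum>j\<in>UNIV. \<Sum>i\<in>UNIV. A$i$k * B$k$j * C$i$j)"
    by (intro sum.cong refl sum.swap)
  also have "\<dots> = B \<bullet> (transpose A ** C)"
    by (simp add: inner_vec_def matrix_matrix_mult_def transpose_def sum_distrib_left mult_ac)
  finally show ?thesis .
qed

lemma inner_transpose:
  fixes A B :: "real^'n^'m"
  shows "transpose A \<bullet> transpose B = A \<bullet> B"
  unfolding inner_vec_def transpose_def by (simp, rule sum.swap)

lemma inner_matrix_mul_right:
  fixes A :: "real^'k^'m" and B :: "real^'n^'k" and C :: "real^'n^'m"
  shows "(A ** B) \<bullet> C = A \<bullet> (C ** transpose B)"
proof -
  have "(A ** B) \<bullet> C = (transpose B ** transpose A) \<bullet> transpose C"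
    by (simp only: inner_transpose[symmetric, of "A ** B"] matrix_transpose_mul)
  also have "\<dots> = transpose A \<bullet> transpose (C ** transpose B)"
    by (simp only: inner_matrix_mul_left matrix_transpose_mul)
  finally show ?thesis by (simp only: inner_transpose)
qed

lemma norm_transpose: "norm (transpose A) = norm (A :: real^'n^'m)"
  by (simp add: norm_eq_sqrt_inner inner_transpose)

lemma transpose_plus: "transpose (A + B) = transpose A + transpose B"
  and transpose_minus: "transpose (A - B) = transpose A - transpose (B :: real^'n^'m)"
  and transpose_uminus: "transpose (- B) = - transpose B"
  by (simp_all add: transpose_def vec_eq_iff)

lemma transpose_sum: "transpose (sum f S) = (\<Sum>i\<in>S. transpose (f i :: real^'n^'m))"
  by (simp add: transpose_def vec_eq_iff)

lemma sum_matrix_vector_mult: "sum f S *v x = (\<Sum>i\<in>S. f i *v (x :: real^'n))"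
  by (induction S rule: infinite_finite_induct) (simp_all add: matrix_vector_mult_add_rdistrib)

lemma matrix_sub_ldistrib: "A ** (B - C) = A ** B - A ** (C :: real^'n^'k)"
  by (simp add: matrix_matrix_mult_def vec_eq_iff right_diff_distrib sum_subtractf)

lemma matrix_add_rdistrib: "(A + B) ** C = A ** C + B ** (C :: real^'n^'k)"
  by (simp add: matrix_matrix_mult_def vec_eq_iff distrib_right sum.distrib)

lemma matrix_sub_rdistrib: "(A - B) ** C = A ** C - B ** (C :: real^'n^'k)"
  by (simp add: matrix_matrix_mult_def vec_eq_iff left_diff_distrib sum_subtractf)

lemma inner_matrix_vector_mult_swap:
  fixes A :: "real^'n^'m"
  shows "x \<bullet> (A *v y) = (transpose A *v x) \<bullet> y"
  by (simp add: dot_lmul_matrix)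

lemma outer_mult_vector: "outer u w *v x = (w \<bullet> x) *\<^sub>R u"
  by (simp add: outer_def matrix_vector_mult_def vec_eq_iff inner_vec_def sum_distrib_left mult_ac)

lemma inner_outer: "outer u w \<bullet> B = u \<bullet> (B *v w)"
  by (simp add: outer_def matrix_vector_mult_def inner_vec_def sum_distrib_left mult_ac)

lemma transpose_outer: "transpose (outer u w) = outer w u"
  by (simp add: outer_def transpose_def vec_eq_iff mult_ac)

text \<open>A first-variation argument: near zero a linear term beats any quadratic one. Testing
  \<open>t = b / c\<close> with some \<open>c > K\<close> already forces
  \<open>b = 0\<close>.\<close>

lemma linear_le_quadratic_imp_zero:
  fixes b K :: real
  assumes "\<And>t. b * t \<le> t\<^sup>2 * K"
  shows "b = 0"
proof -
  define c where "c = \<bar>K\<bar> + 1"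
  have c: "c > 0" "K < c" by (auto simp: c_def)
  have "b * (b / c) \<le> (b / c)\<^sup>2 * K" by (rule assms)
  then have "b\<^sup>2 * c \<le> b\<^sup>2 * K"
    using c by (simp add: field_simps power2_eq_square)
  with c show ?thesis
    by (metis linorder_not_less mult_strict_left_mono zero_less_power2)
qed

subsection \<open>Orthonormal sequences and the spectral theorem\<close>

text \<open>The length \<open>k\<close> is kept apart from the dimension, so that an eigenbasis can
  be built one vector at a time.\<close>

definition orthonormal_seq :: "nat \<Rightarrow> (nat \<Rightarrow> real^'n) \<Rightarrow> bool" where
  "orthonormal_seq k v \<longleftrightarrow> (\<forall>i<k. \<forall>j<k. v i \<bullet> v j = (if i = j then 1 else 0))"

lemma orthonormal_seqD:
  "orthonormal_seq k v \<Longrightarrow> i < k \<Longrightarrow> j < k \<Longrightarrow> v i \<bullet> v j = (if i = j then 1 else 0)"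
  by (simp add: orthonormal_seq_def)

lemma eig_decomp_iff:
  "eig_decomp (X :: real^'n^'n) v l \<longleftrightarrow>
     orthonormal_seq CARD('n) v \<and> X = (\<Sum>i<CARD('n). l i *\<^sub>R outer (v i) (v i))"
  by (simp add: eig_decomp_def orthonormal_seq_def)

lemma orthonormal_seq_independent:
  assumes "orthonormal_seq k v"
  shows "inj_on v {..<k}" "independent (v ` {..<k})" "card (v ` {..<k}) = k"
proof -
  show inj: "inj_on v {..<k}"
    by (rule inj_onI) (metis assms lessThan_iff orthonormal_seqD zero_neq_one)
  show "card (v ` {..<k}) = k"
    by (simp add: card_image inj)
  have "pairwise orthogonal (v ` {..<k})"
    using assms by (auto simp: pairwise_def orthogonal_def dest!: orthonormal_seqD)
       (metis assms orthonormal_seqD)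
  moreover have "0 \<notin> v ` {..<k}"
    using assms by (auto simp: orthonormal_seq_def) (metis inner_zero_left zero_neq_one)
  ultimately show "independent (v ` {..<k})"
    by (rule pairwise_orthogonal_independent)
qed

lemma orthonormal_seq_expansion:
  fixes v :: "nat \<Rightarrow> real^'n"
  assumes v: "orthonormal_seq CARD('n) v"
  shows "x = (\<Sum>i<CARD('n). (v i \<bullet> x) *\<^sub>R v i)"
proof -
  define y where "y = x - (\<Sum>i<CARD('n). (v i \<bullet> x) *\<^sub>R v i)"
  have orth: "orthogonal y (v j)" if "j < CARD('n)" for j
  proof -
    have "(\<Sum>i<CARD('n). (v i \<bullet> x) * (v i \<bullet> v j)) = (\<Sum>i<CARD('n). if i = j then v i \<bullet> x else 0)"
      using that v by (intro sum.cong refl) (simp add: orthonormal_seqD)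
    also have "\<dots> = v j \<bullet> x" using that by simp
    finally show ?thesis
      by (simp add: orthogonal_def y_def inner_diff_left inner_sum_left inner_commute[of x])
  qed
  have "span (v ` {..<CARD('n)}) = UNIV"
    using orthonormal_seq_independent[OF v]
    by (simp add: dim_eq_full[symmetric] dim_eq_card_independent)
  then have "y \<in> span (v ` {..<CARD('n)})" by simp
  then have "orthogonal y y"
    by (rule orthogonal_to_span) (use orth in auto)
  then show ?thesis by (simp add: orthogonal_def y_def)
qed

lemma orthonormal_seq_parseval_inner:
  fixes v :: "nat \<Rightarrow> real^'n"
  assumes v: "orthonormal_seq CARD('n) v"
  shows "(\<Sum>i<CARD('n). (v i \<bullet> x) * (v i \<bullet> y)) = x \<bullet> y"
  using arg_cong[OF orthonormal_seq_expansion[OF v, of x], of "\<lambda>z. z \<bullet> y"]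
  by (simp add: inner_sum_left)

lemma orthonormal_seq_parseval:
  fixes v :: "nat \<Rightarrow> real^'n"
  assumes v: "orthonormal_seq CARD('n) v"
  shows "(\<Sum>i<CARD('n). (v i \<bullet> x)\<^sup>2) = (norm x)\<^sup>2"
  using orthonormal_seq_parseval_inner[OF v, of x x]
  by (simp add: power2_eq_square power2_norm_eq_inner[symmetric])

text \<open>Parseval applied to each row of \<open>A\<close>, followed by an exchange of
  sums.\<close>

lemma norm_matrix_orthonormal_seq:
  fixes A :: "real^'n^'m"
  assumes v: "orthonormal_seq CARD('n) v"
  shows "(norm A)\<^sup>2 = (\<Sum>j<CARD('n). (norm (A *v v j))\<^sup>2)"
proof -
  have "(norm A)\<^sup>2 = (\<Sum>i\<in>UNIV. (norm (A $ i))\<^sup>2)"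
    by (simp add: power2_norm_eq_inner inner_vec_def)
  also have "\<dots> = (\<Sum>i\<in>UNIV. \<Sum>j<CARD('n). (v j \<bullet> A $ i)\<^sup>2)"
    by (simp add: orthonormal_seq_parseval[OF v])
  also have "\<dots> = (\<Sum>j<CARD('n). \<Sum>i\<in>UNIV. (v j \<bullet> A $ i)\<^sup>2)"
    by (rule sum.swap)
  also have "\<dots> = (\<Sum>j<CARD('n). (norm (A *v v j))\<^sup>2)"
    unfolding power2_norm_eq_inner
    by (simp add: inner_vec_def matrix_vector_mult_def power2_eq_square mult.commute)
  finally show ?thesis .
qed

section \<open>Weighted sums of rank-one projections\<close>

lemma sum_outer_mult_vector:
  "(\<Sum>i\<in>S. l i *\<^sub>R outer (v i) (v i)) *v x = (\<Sum>i\<in>S. (l i * (v i \<bullet> x)) *\<^sub>R v i)"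
  by (simp add: sum_matrix_vector_mult outer_mult_vector scaleR_matrix_vector_assoc[symmetric])

lemma sum_outer_mult_basis:
  assumes v: "orthonormal_seq k v" and S: "S \<subseteq> {..<k}" and j: "j < k"
  shows "(\<Sum>i\<in>S. l i *\<^sub>R outer (v i) (v i)) *v v j = (if j \<in> S then l j *\<^sub>R v j else 0)"
proof -
  have fin: "finite S" using S finite_subset by blast
  have "(\<Sum>i\<in>S. (l i * (v i \<bullet> v j)) *\<^sub>R v i) = (\<Sum>i\<in>S. if i = j then l j *\<^sub>R v j else 0)"
    using S j v by (intro sum.cong refl) (auto simp: orthonormal_seqD)
  with fin show ?thesis by (simp add: sum_outer_mult_vector)
qed

lemma sum_outer_symmetric:
  "transpose (\<Sum>i\<in>S. l i *\<^sub>R outer (v i) (v i)) = (\<Sum>i\<in>S. l i *\<^sub>R outer (v i) (v i))"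
  by (simp add: transpose_sum transpose_scalar transpose_outer scalar_mult_eq_scaleR)

lemma psd_sum_outer:
  assumes "\<And>i. i \<in> S \<Longrightarrow> 0 \<le> l i"
  shows "psd (\<Sum>i\<in>S. l i *\<^sub>R outer (v i) (v i))"
  unfolding psd_def
proof (intro conjI allI)
  fix x
  have "x \<bullet> ((\<Sum>i\<in>S. l i *\<^sub>R outer (v i) (v i)) *v x) = (\<Sum>i\<in>S. l i * (v i \<bullet> x)\<^sup>2)"
    by (simp add: sum_outer_mult_vector inner_sum_right power2_eq_square mult_ac inner_commute)
  then show "0 \<le> x \<bullet> ((\<Sum>i\<in>S. l i *\<^sub>R outer (v i) (v i)) *v x)"
    using assms by (simp add: sum_nonneg)
qed (rule sum_outer_symmetric)

lemma inner_sum_outer_nonneg: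
  assumes "\<And>i. i \<in> S \<Longrightarrow> 0 \<le> l i" and "psd X"
  shows "0 \<le> (\<Sum>i\<in>S. l i *\<^sub>R outer (v i) (v i)) \<bullet> X"
  using assms by (simp add: inner_sum_left inner_outer psd_def sum_nonneg)

lemma matrix_eqI_orthonormal_seq:
  fixes A B :: "real^'n^'m"
  assumes v: "orthonormal_seq CARD('n) v" and eq: "\<And>j. j < CARD('n) \<Longrightarrow> A *v v j = B *v v j"
  shows "A = B"
proof -
  have "(norm (A - B))\<^sup>2 = 0"
    by (simp add: norm_matrix_orthonormal_seq[OF v] matrix_vector_mult_diff_rdistrib eq)
  then show ?thesis by simp
qed

lemma eig_decompI:
  fixes A :: "real^'n^'n"
  assumes v: "orthonormal_seq CARD('n) v" and eq: "\<And>j. j < CARD('n) \<Longrightarrow> A *v v j = l j *\<^sub>R v j"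
  shows "eig_decomp A v l"
  unfolding eig_decomp_iff
  by (auto intro!: v matrix_eqI_orthonormal_seq[OF v] simp: eq sum_outer_mult_basis[OF v])

lemma eig_decomp_eigenvector:
  fixes A :: "real^'n^'n"
  assumes "eig_decomp A v l" "j < CARD('n)"
  shows "A *v v j = l j *\<^sub>R v j"
  using assms by (auto simp: eig_decomp_iff sum_outer_mult_basis)

lemma eig_decomp_eigenvalue_ge:
  fixes A :: "real^'n^'n"
  assumes "eig_decomp A v l" "j < CARD('n)" and "\<And>x. c * (norm x)\<^sup>2 \<le> x \<bullet> (A *v x)"
  shows "c \<le> l j"
proof -
  have "v j \<bullet> v j = 1" using assms(1,2) by (auto simp: eig_decomp_iff orthonormal_seqD)
  then show ?thesis
    using assms(3)[of "v j"] by (simp add: eig_decomp_eigenvector[OF assms(1,2)] power2_norm_eq_inner)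
qed

text \<open>The unit sphere cut by \<open>k\<close> hyperplanes is compact, and nonempty because
  fewer vectors than the dimension cannot span. Homogeneity carries the bound from unit vectors to
  all admissible \<open>x\<close>.\<close>

lemma rayleigh_max_exists:
  fixes A :: "real^'n^'n" and v :: "nat \<Rightarrow> real^'n"
  assumes v: "orthonormal_seq k v" and k: "k < CARD('n)"
  obtains w where "norm w = 1" "\<And>i. i < k \<Longrightarrow> v i \<bullet> w = 0"
    "\<And>x. (\<And>i. i < k \<Longrightarrow> v i \<bullet> x = 0) \<Longrightarrow> x \<bullet> (A *v x) \<le> (w \<bullet> (A *v w)) * (norm x)\<^sup>2"
proof -
  define S where "S = sphere (0 :: real^'n) 1 \<inter> (\<Inter>i<k. {x. v i \<bullet> x = 0})"
  have "compact S"
    unfolding S_def by (intro compact_Int_closed compact_sphere closed_INT ballI closed_hyperplane)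
  moreover have "S \<noteq> {}"
  proof -
    have "dim (v ` {..<k}) < DIM(real^'n)"
      using orthonormal_seq_independent[OF v] k by (simp add: dim_eq_card_independent)
    then obtain x where x: "x \<noteq> 0" "\<And>y. y \<in> span (v ` {..<k}) \<Longrightarrow> orthogonal x y"
      using orthogonal_to_subspace_exists by blast
    then have "v i \<bullet> x = 0" if "i < k" for i
      using that by (metis imageI inner_commute lessThan_iff orthogonal_def span_base)
    then have "x /\<^sub>R norm x \<in> S"
      using x(1) by (auto simp: S_def)
    then show ?thesis by blast
  qed
  moreover have "continuous_on S (\<lambda>x. x \<bullet> (A *v x))"
    by (intro continuous_intros linear_continuous_on matrix_vector_mul_bounded_linear)
  ultimately obtain w where w: "w \<in> S" "\<And>x. x \<in> S \<Longrightarrow> x \<bullet> (A *v x) \<le> w \<bullet> (A *v w)"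
    using continuous_attains_sup by metis
  show ?thesis
  proof (rule that[of w])
    show "norm w = 1" "\<And>i. i < k \<Longrightarrow> v i \<bullet> w = 0" using w(1) by (auto simp: S_def)
    fix x assume x: "\<And>i. i < k \<Longrightarrow> v i \<bullet> x = 0"
    show "x \<bullet> (A *v x) \<le> (w \<bullet> (A *v w)) * (norm x)\<^sup>2"
    proof (cases "x = 0")
      case False
      then have "x /\<^sub>R norm x \<in> S" using x by (auto simp: S_def)
      from w(2)[OF this] False show ?thesis
        by (simp add: matrix_vector_mult_scaleR field_simps power2_eq_square)
    qed simp
  qed
qed

lemma symmetric_inner_swap:
  fixes A :: "real^'n^'n"
  assumes "transpose A = A"
  shows "x \<bullet> (A *v y) = (A *v x) \<bullet> y"
  by (metis assms inner_matrix_vector_mult_swap)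

text \<open>The residual \<open>y\<close> of the eigenvalue equation is itself an admissible
  direction. Moving from \<open>w\<close> along \<open>t *\<^sub>R y\<close> leaves
  \<open>2 * (y \<bullet> y)\<close> as first-order coefficient, which maximality forces to
  vanish.\<close>

lemma rayleigh_max_eigenvector:
  fixes A :: "real^'n^'n"
  assumes sym: "transpose A = A" and w: "norm w = 1" "\<And>i. i < k \<Longrightarrow> v i \<bullet> w = 0"
    and eig: "\<And>i. i < k \<Longrightarrow> A *v v i = l i *\<^sub>R v i"
    and max: "\<And>x. (\<And>i. i < k \<Longrightarrow> v i \<bullet> x = 0) \<Longrightarrow> x \<bullet> (A *v x) \<le> (w \<bullet> (A *v w)) * (norm x)\<^sup>2"
  shows "A *v w = (w \<bullet> (A *v w)) *\<^sub>R w"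
proof -
  define c where "c = w \<bullet> (A *v w)"
  define y where "y = A *v w - c *\<^sub>R w"
  \<comment> \<open>By symmetry \<open>A\<close> moves onto \<open>v i\<close>, where it acts as a
    scalar.\<close>
  have y: "v i \<bullet> y = 0" if "i < k" for i
    using that w(2) by (simp add: y_def inner_diff_right symmetric_inner_swap[OF sym] eig)
  have ww: "w \<bullet> w = 1" using w(1) by (simp add: norm_eq_1)
  have "2 * (y \<bullet> y) * t \<le> t\<^sup>2 * (c * (y \<bullet> y) - y \<bullet> (A *v y))" for t
  proof -
    have max': "(w + t *\<^sub>R y) \<bullet> (A *v (w + t *\<^sub>R y)) \<le> c * (norm (w + t *\<^sub>R y))\<^sup>2"
      unfolding c_def by (rule max) (simp add: inner_add_right w(2) y)
    have quad: "(w + t *\<^sub>R y) \<bullet> (A *v (w + t *\<^sub>R y))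
        = c + 2 * t * (y \<bullet> (A *v w)) + t\<^sup>2 * (y \<bullet> (A *v y))"
      using symmetric_inner_swap[OF sym, of w y]
      by (simp add: c_def algebra_simps power2_eq_square inner_commute)
    have sq: "(norm (w + t *\<^sub>R y))\<^sup>2 = 1 + 2 * t * (y \<bullet> w) + t\<^sup>2 * (y \<bullet> y)"
      unfolding power2_norm_eq_inner
      by (simp add: algebra_simps power2_eq_square inner_commute ww)
    have "A *v w = y + c *\<^sub>R w" by (simp add: y_def)
    then have yAw: "y \<bullet> (A *v w) = y \<bullet> y + c * (y \<bullet> w)"
      by (simp add: inner_add_right)
    show ?thesis
      using max' unfolding quad sq yAw by (simp add: algebra_simps)
  qed
  from linear_le_quadratic_imp_zero[OF this] have "y = 0" by simp
  then show ?thesis by (simp add: y_def c_def)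
qed

text \<open>Greedy construction by induction on \<open>k\<close>. The last conjunct strengthens the
  induction hypothesis: it keeps the next Rayleigh maximum below all earlier eigenvalues, hence the
  order decreasing.\<close>

lemma symmetric_partial_eigenbasis:
  fixes A :: "real^'n^'n"
  assumes sym: "transpose A = A" and "k \<le> CARD('n)"
  shows "\<exists>v l. orthonormal_seq k v \<and> (\<forall>i<k. A *v v i = l i *\<^sub>R v i) \<and> desc_sorted k l \<and>
    (\<forall>x. (\<forall>i<k. v i \<bullet> x = 0) \<longrightarrow> (\<forall>i<k. x \<bullet> (A *v x) \<le> l i * (norm x)\<^sup>2))"
  using assms(2)
proof (induction k)
  case 0
  show ?case by (auto simp: orthonormal_seq_def desc_sorted_def)
next
  case (Suc k)
  then obtain v l where v: "orthonormal_seq k v" and eig: "\<And>i. i < k \<Longrightarrow> A *v v i = l i *\<^sub>R v i"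
    and sorted: "desc_sorted k l"
    and bound: "\<And>x i. (\<And>i. i < k \<Longrightarrow> v i \<bullet> x = 0) \<Longrightarrow> i < k \<Longrightarrow> x \<bullet> (A *v x) \<le> l i * (norm x)\<^sup>2"
    by force
  obtain w where w: "norm w = 1" "\<And>i. i < k \<Longrightarrow> v i \<bullet> w = 0"
    and max: "\<And>x. (\<And>i. i < k \<Longrightarrow> v i \<bullet> x = 0) \<Longrightarrow> x \<bullet> (A *v x) \<le> (w \<bullet> (A *v w)) * (norm x)\<^sup>2"
    using rayleigh_max_exists[OF v, of A] Suc.prems by (metis Suc_le_eq)
  define c where "c = w \<bullet> (A *v w)"
  have Aw: "A *v w = c *\<^sub>R w"
    unfolding c_def using rayleigh_max_eigenvector[OF sym w eig max] .
  have cl: "c \<le> l i" if "i < k" for i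
    using bound[OF w(2) that] w(1) by (simp add: c_def)
  have ww: "w \<bullet> w = 1" using w(1) by (simp add: norm_eq_1)
  show ?case
  proof (intro exI conjI allI impI)
    show "orthonormal_seq (Suc k) (v(k := w))"
      using v w(2) ww by (auto simp: orthonormal_seq_def less_Suc_eq inner_commute)
    show "A *v (v(k := w)) i = (l(k := c)) i *\<^sub>R (v(k := w)) i" if "i < Suc k" for i
      using that eig Aw by (auto simp: less_Suc_eq)
    show "desc_sorted (Suc k) (l(k := c))"
      using sorted cl by (auto simp: desc_sorted_def less_Suc_eq)
    fix x i assume x: "\<forall>i<Suc k. (v(k := w)) i \<bullet> x = 0" and i: "i < Suc k"
    then have "\<And>i. i < k \<Longrightarrow> v i \<bullet> x = 0" by (metis fun_upd_other less_SucI less_irrefl)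
    from max[OF this] bound[OF this] i
    show "x \<bullet> (A *v x) \<le> (l(k := c)) i * (norm x)\<^sup>2"
      by (auto simp: c_def less_Suc_eq)
  qed
qed

theorem symmetric_eig_decomp_exists:
  fixes A :: "real^'n^'n"
  assumes "transpose A = A"
  obtains v l where "eig_decomp A v l" "desc_sorted CARD('n) l"
  using symmetric_partial_eigenbasis[OF assms order_refl] eig_decompI by metis

text \<open>
  Two eigenbases \<open>v\<close>, \<open>w\<close> of the same matrix have \<open>v i \<bullet> w j = 0\<close> unless the eigenvalues agree, and
  \<open>(v i \<bullet> w j)\<^sup>2\<close> is doubly stochastic, so counting eigenvalues above \<open>c\<close> amounts to summing a block
  of this matrix in two ways.
\<close>

lemma eig_decomp_card_gt:
  fixes A :: "real^'n^'n"
  assumes a: "eig_decomp A v l" and b: "eig_decomp A w \<mu>"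
  shows "card {i. i < CARD('n) \<and> c < l i} \<le> card {j. j < CARD('n) \<and> c < \<mu> j}"
proof -
  let ?n = "CARD('n)"
  define I where "I = {i. i < ?n \<and> c < l i}"
  define J where "J = {j. j < ?n \<and> c < \<mu> j}"
  have v: "orthonormal_seq ?n v" and w: "orthonormal_seq ?n w"
    using a b by (auto simp: eig_decomp_iff)
  have sym: "transpose A = A" using a by (simp add: eig_decomp_iff sum_outer_symmetric)
  have zero: "v i \<bullet> w j = 0" if "i < ?n" "j < ?n" "l i \<noteq> \<mu> j" for i j
    using symmetric_inner_swap[OF sym, of "v i" "w j"] that
    by (simp add: eig_decomp_eigenvector[OF a] eig_decomp_eigenvector[OF b])
  have "real (card I) = (\<Sum>i\<in>I. (norm (v i))\<^sup>2)"
    using orthonormal_seqD[OF v] by (simp add: I_def power2_norm_eq_inner)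
  also have "\<dots> = (\<Sum>i\<in>I. \<Sum>j<?n. (w j \<bullet> v i)\<^sup>2)"
    by (simp add: orthonormal_seq_parseval[OF w])
  also have "\<dots> = (\<Sum>i\<in>I. \<Sum>j\<in>J. (w j \<bullet> v i)\<^sup>2)"
    by (intro sum.cong refl sum.mono_neutral_right)
       (auto simp: I_def J_def inner_commute intro!: zero)
  also have "\<dots> = (\<Sum>j\<in>J. \<Sum>i\<in>I. (v i \<bullet> w j)\<^sup>2)"
    by (subst sum.swap) (simp add: inner_commute)
  also have "\<dots> \<le> (\<Sum>j\<in>J. \<Sum>i<?n. (v i \<bullet> w j)\<^sup>2)"
    by (intro sum_mono sum_mono2) (auto simp: I_def)
  also have "\<dots> = real (card J)"
    using orthonormal_seqD[OF w] by (simp add: orthonormal_seq_parseval[OF v] J_def power2_norm_eq_inner)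
  finally show ?thesis by (simp add: I_def J_def)
qed

text \<open>By counting: if \<open>\<mu> i < l i\<close>, then at least \<open>i + 1\<close> of the
  \<open>l j\<close> exceed \<open>\<mu> i\<close>, whereas at most \<open>i\<close> of the
  \<open>\<mu> j\<close> do.\<close>

lemma eig_decomp_sorted_le:
  fixes A :: "real^'n^'n"
  assumes a: "eig_decomp A v l" "desc_sorted CARD('n) l"
    and b: "eig_decomp A w \<mu>" "desc_sorted CARD('n) \<mu>" and i: "i < CARD('n)"
  shows "l i \<le> \<mu> i"
proof (rule ccontr)
  assume neg: "\<not> l i \<le> \<mu> i"
  have "Suc i = card {..i}" by simp
  also have "\<dots> \<le> card {j. j < CARD('n) \<and> \<mu> i < l j}"
    using a(2) i neg by (intro card_mono) (fastforce simp: desc_sorted_def)+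
  also have "\<dots> \<le> card {j. j < CARD('n) \<and> \<mu> i < \<mu> j}"
    by (rule eig_decomp_card_gt[OF a(1) b(1)])
  also have "\<dots> \<le> card {..<i}"
    using b(2) i by (intro card_mono) (auto simp: desc_sorted_def not_le[symmetric])
  finally show False by simp
qed

text \<open>Comparing sorted spectra in both directions shows that the choice made by
  \<open>SOME\<close> does not matter. Every singular value below is evaluated through this
  fact.\<close>

lemma eigval_desc_eq:
  fixes A :: "real^'n^'n"
  assumes "eig_decomp A v l" "desc_sorted CARD('n) l" "i < CARD('n)"
  shows "eigval_desc A i = l i"
proof -
  have "(\<exists>v. eig_decomp A v (eigval_desc A)) \<and> desc_sorted CARD('n) (eigval_desc A)"
    unfolding eigval_desc_def
    by (rule someI_ex[of "\<lambda>l. (\<exists>v. eig_decomp A v l) \<and> desc_sorted CARD('n) l"]) (use assms in blast)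
  then obtain w where w: "eig_decomp A w (eigval_desc A)" "desc_sorted CARD('n) (eigval_desc A)"
    by blast
  show ?thesis
    by (rule order_antisym[OF eig_decomp_sorted_le[OF w assms] eig_decomp_sorted_le[OF assms(1,2) w assms(3)]])
qed

subsection \<open>Best low-rank approximation\<close>

text \<open>A bathtub argument with threshold \<open>a r\<close>. Once it is subtracted, entries
  from \<open>r\<close> on are nonpositive, so a weight of at most one can only increase them, and
  earlier entries are nonnegative. The subtracted terms agree because the total weight is
  \<open>n - r\<close>.\<close>

lemma sum_tail_le_weighted_sum:
  fixes a q :: "nat \<Rightarrow> real"
  assumes sorted: "desc_sorted n a" and r: "r \<le> n"
    and q: "\<And>i. i < n \<Longrightarrow> 0 \<le> q i" "\<And>i. i < n \<Longrightarrow> q i \<le> 1"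
    and total: "(\<Sum>i<n. q i) = real (n - r)" and nonneg: "\<And>i. i < n \<Longrightarrow> 0 \<le> a i"
  shows "(\<Sum>i\<in>{r..<n}. a i) \<le> (\<Sum>i<n. a i * q i)"
proof (cases "r = n")
  case True
  \<comment> \<open>For \<open>r = n\<close> the threshold \<open>a r\<close> lies beyond the sorted
    range, and the left side is an empty sum.\<close>
  have "0 \<le> (\<Sum>i<n. a i * q i)"
    by (intro sum_nonneg mult_nonneg_nonneg) (auto intro: q nonneg)
  with True show ?thesis by simp
next
  case False
  with r have "r < n" by simp
  have "(\<Sum>i\<in>{r..<n}. a i - a r) \<le> (\<Sum>i\<in>{r..<n}. (a i - a r) * q i)"
  proof (intro sum_mono)
    fix i assume "i \<in> {r..<n}"
    then have "a i - a r \<le> 0" "q i \<le> 1" using sorted q(2) by (auto simp: desc_sorted_def)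
    then show "a i - a r \<le> (a i - a r) * q i" by (simp add: mult_le_cancel_left1)
  qed
  also have "\<dots> \<le> (\<Sum>i<n. (a i - a r) * q i)"
    using sorted q(1) \<open>r < n\<close> by (intro sum_mono2) (auto simp: desc_sorted_def)
  also have "\<dots> = (\<Sum>i<n. a i * q i) - a r * real (n - r)"
    by (simp add: left_diff_distrib sum_subtractf sum_distrib_left[symmetric] total)
  finally show ?thesis by (simp add: sum_subtractf mult.commute)
qed

text \<open>Eckart--Young in the Frobenius norm; the rank bound on \<open>B\<close> is expressed by
  an orthonormal basis whose tail \<open>B\<close> kills. On that tail \<open>X - B\<close> acts as
  \<open>X\<close>, and expanding \<open>X *v w j\<close> in the eigenbasis weights each
  \<open>(l i)\<^sup>2\<close> by \<open>q i\<close>.\<close>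

lemma truncation_best_approximation:
  fixes X B :: "real^'n^'n"
  assumes X: "eig_decomp X v l" and sorted: "desc_sorted CARD('n) l"
    and nonneg: "\<And>i. i < CARD('n) \<Longrightarrow> 0 \<le> l i" and r: "r \<le> CARD('n)"
    and w: "orthonormal_seq CARD('n) w" and B: "\<And>j. r \<le> j \<Longrightarrow> j < CARD('n) \<Longrightarrow> B *v w j = 0"
  shows "norm (X - (\<Sum>i<r. l i *\<^sub>R outer (v i) (v i))) \<le> norm (X - B)"
proof -
  let ?n = "CARD('n)" and ?T = "\<Sum>i<r. l i *\<^sub>R outer (v i) (v i)"
  define q where "q i = (\<Sum>j\<in>{r..<?n}. (w j \<bullet> v i)\<^sup>2)" for i
  have v: "orthonormal_seq ?n v" using X by (simp add: eig_decomp_iff)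
  have sym: "transpose X = X" using X by (simp add: eig_decomp_iff sum_outer_symmetric)
  have unit: "norm (v i) = 1" "norm (w i) = 1" if "i < ?n" for i
    using that v w by (simp_all add: norm_eq_1 orthonormal_seqD)
  have "(norm (X - ?T))\<^sup>2 = (\<Sum>i<?n. (norm (X *v v i - ?T *v v i))\<^sup>2)"
    by (simp add: norm_matrix_orthonormal_seq[OF v] matrix_vector_mult_diff_rdistrib)
  also have "\<dots> = (\<Sum>i<?n. if i \<in> {r..<?n} then (l i)\<^sup>2 else 0)"
    using r by (intro sum.cong refl)
      (auto simp: eig_decomp_eigenvector[OF X] sum_outer_mult_basis[OF v] unit)
  also have "\<dots> = (\<Sum>i\<in>{r..<?n}. (l i)\<^sup>2)"
    by (subst sum.inter_restrict[symmetric]) (auto intro!: sum.cong)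
  also have "\<dots> \<le> (\<Sum>i<?n. (l i)\<^sup>2 * q i)"
  proof (rule sum_tail_le_weighted_sum)
    \<comment> \<open>Nonnegativity makes squaring monotone, so the squares inherit the
      order.\<close>
    show "desc_sorted ?n (\<lambda>i. (l i)\<^sup>2)"
      using sorted nonneg by (auto simp: desc_sorted_def intro!: power_mono)
    show "0 \<le> q i" for i by (simp add: q_def sum_nonneg)
    show "q i \<le> 1" if "i < ?n" for i
    proof -
      have "q i \<le> (\<Sum>j<?n. (w j \<bullet> v i)\<^sup>2)"
        unfolding q_def by (intro sum_mono2) auto
      then show ?thesis by (simp add: orthonormal_seq_parseval[OF w] unit that)
    qed
    have "(\<Sum>i<?n. q i) = (\<Sum>j\<in>{r..<?n}. \<Sum>i<?n. (v i \<bullet> w j)\<^sup>2)"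
      unfolding q_def by (subst sum.swap) (simp add: inner_commute)
    also have "\<dots> = real (?n - r)"
      by (simp add: orthonormal_seq_parseval[OF v] unit)
    finally show "(\<Sum>i<?n. q i) = real (?n - r)" .
  qed (use r in auto)
  also have "\<dots> = (\<Sum>j\<in>{r..<?n}. \<Sum>i<?n. (l i)\<^sup>2 * (v i \<bullet> w j)\<^sup>2)"
    unfolding q_def sum_distrib_left by (subst sum.swap) (simp add: inner_commute)
  also have "\<dots> = (\<Sum>j\<in>{r..<?n}. \<Sum>i<?n. (v i \<bullet> (X *v w j))\<^sup>2)"
    by (intro sum.cong refl)
       (simp add: symmetric_inner_swap[OF sym] eig_decomp_eigenvector[OF X] power_mult_distrib)
  also have "\<dots> = (\<Sum>j\<in>{r..<?n}. (norm ((X - B) *v w j))\<^sup>2)"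
    by (simp add: orthonormal_seq_parseval[OF v] matrix_vector_mult_diff_rdistrib B)
  also have "\<dots> \<le> (\<Sum>j<?n. (norm ((X - B) *v w j))\<^sup>2)"
    by (intro sum_mono2) auto
  also have "\<dots> = (norm (X - B))\<^sup>2"
    by (simp add: norm_matrix_orthonormal_seq[OF w])
  finally show ?thesis by (simp add: power2_le_iff_abs_le)
qed

subsection \<open>The orthogonal Procrustes problem\<close>

lemma compact_orthogonal_matrices: "compact {R :: real^'n^'n. orthogonal_matrix R}"
proof -
  have "norm R = norm (mat 1 :: real^'n^'n)" if "orthogonal_matrix R" for R :: "real^'n^'n"
    using inner_matrix_mul_left[of R "mat 1" R] that
    by (simp add: norm_eq_sqrt_inner orthogonal_matrix)
  then have "bounded {R :: real^'n^'n. orthogonal_matrix R}"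
    by (auto simp: bounded_iff)
  moreover have "closed {R :: real^'n^'n. orthogonal_matrix R}"
    unfolding orthogonal_matrix matrix_matrix_mult_def transpose_def
    by (intro closed_Collect_eq continuous_intros)
  ultimately show ?thesis by (simp add: compact_eq_bounded_closed)
qed

text \<open>For a unit vector \<open>v\<close> this is the reflection in the hyperplane orthogonal
  to \<open>v\<close>.\<close>

definition householder :: "real^'n \<Rightarrow> real^'n^'n" where
  "householder v = mat 1 - 2 *\<^sub>R outer v v"

lemma householder_mult_vector: "householder v *v x = x - (2 * (v \<bullet> x)) *\<^sub>R v"
  by (simp add: householder_def matrix_vector_mult_diff_rdistrib scaleR_matrix_vector_assoc[symmetric] outer_mult_vector)

lemma transpose_householder: "transpose (householder v) = householder v"
  by (simp add: householder_def transpose_minus transpose_scalar transpose_outer scalar_mult_eq_scaleR)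

lemma orthogonal_householder:
  assumes "norm v = 1"
  shows "orthogonal_matrix (householder v)"
proof -
  have "v \<bullet> v = 1" using assms by (simp add: norm_eq_1)
  then have "householder v ** householder v = mat 1"
    by (simp add: matrix_eq matrix_vector_mul_assoc[symmetric] householder_mult_vector inner_diff_right)
  then show ?thesis by (simp add: orthogonal_matrix transpose_householder)
qed

lemma inner_householder: "householder v \<bullet> B = mat 1 \<bullet> B - 2 * (v \<bullet> (B *v v))"
  by (simp add: householder_def inner_diff_left inner_outer)

lemma inner_householder_mul:
  "(householder u ** householder w) \<bullet> B
    = mat 1 \<bullet> B - 2 * (u \<bullet> (B *v u)) - 2 * (w \<bullet> (B *v w)) + 4 * (u \<bullet> (B *v w)) * (u \<bullet> w)"
proof -
  have "mat 1 \<bullet> (householder u ** B) = householder u \<bullet> B"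
    using inner_matrix_mul_left[of "householder u" "mat 1" B] by (simp add: transpose_householder)
  then show ?thesis
    unfolding inner_matrix_mul_left transpose_householder inner_householder[of w]
    by (simp add: inner_householder[of u] matrix_vector_mul_assoc[symmetric]
        householder_mult_vector inner_diff_right inner_commute[of w u])
qed

text \<open>
  Testing maximality against one reflection gives nonnegativity of the quadratic form; testing it
  against a product of two, that is a rotation by a small angle, gives symmetry.
\<close>

lemma psd_if_trace_maximal:
  fixes B :: "real^'n^'n"
  assumes max: "\<And>Q. orthogonal_matrix Q \<Longrightarrow> Q \<bullet> B \<le> mat 1 \<bullet> B"
  shows "psd B"
  unfolding psd_def
proof (intro conjI allI)
  fix x
  show "0 \<le> x \<bullet> (B *v x)"
  proof (cases "x = 0")
    case False
    then have "householder (x /\<^sub>R norm x) \<bullet> B \<le> mat 1 \<bullet> B"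
      by (intro max orthogonal_householder) simp
    with False show ?thesis
      by (simp add: inner_householder matrix_vector_mult_scaleR zero_le_mult_iff)
  qed simp
next
  \<comment> \<open>Multiplying by \<open>(norm w)\<^sup>2\<close> frees the second vector from its
    normalisation and makes the inequality polynomial in \<open>w\<close>.\<close>
  have rot: "2 * (u \<bullet> (B *v w)) * (u \<bullet> w) \<le> (u \<bullet> (B *v u)) * (w \<bullet> w) + w \<bullet> (B *v w)"
    if u: "norm u = 1" and "w \<noteq> 0" for u w
  proof -
    define z where "z = w /\<^sub>R norm w"
    have z: "norm z = 1" and w: "w = norm w *\<^sub>R z" using \<open>w \<noteq> 0\<close> by (simp_all add: z_def)
    have "(householder u ** householder z) \<bullet> B \<le> mat 1 \<bullet> B"
      by (intro max orthogonal_matrix_mul orthogonal_householder u z)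
    then have "2 * (u \<bullet> (B *v z)) * (u \<bullet> z) \<le> (u \<bullet> (B *v u)) + z \<bullet> (B *v z)"
      by (simp add: inner_householder_mul)
    then have "(norm w)\<^sup>2 * (2 * (u \<bullet> (B *v z)) * (u \<bullet> z)) \<le> (norm w)\<^sup>2 * ((u \<bullet> (B *v u)) + z \<bullet> (B *v z))"
      by (rule mult_left_mono) simp
    moreover have "z \<bullet> z = 1" using z by (simp add: norm_eq_1)
    ultimately show ?thesis
      by (subst (1 2 3 4 5 6) w) (simp add: matrix_vector_mult_scaleR power2_eq_square algebra_simps)
  qed
  have sym: "axis i 1 \<bullet> (B *v axis j 1) = axis j 1 \<bullet> (B *v axis i 1)" for i j :: 'n
  proof (cases "i = j")
    case False
    let ?u = "axis i 1 :: real^'n" and ?z = "axis j 1 :: real^'n"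
    have uz: "?u \<bullet> ?z = 0" "?z \<bullet> ?u = 0" "?u \<bullet> ?u = 1" "?z \<bullet> ?z = 1"
      using False by (auto simp: inner_axis_axis)
    \<comment> \<open>This is \<open>rot\<close> for \<open>w = ?u + t *\<^sub>R ?z\<close>: the
      constant terms cancel, and the linear coefficient is the difference of two mirrored entries of
      \<open>B\<close>.\<close>
    have "(?u \<bullet> (B *v ?z) - ?z \<bullet> (B *v ?u)) * t \<le> t\<^sup>2 * (?u \<bullet> (B *v ?u) + ?z \<bullet> (B *v ?z))" for t
    proof -
      have "?u \<bullet> (?u + t *\<^sub>R ?z) = 1" by (simp add: inner_add_right uz)
      then have "?u + t *\<^sub>R ?z \<noteq> 0" by fastforce
      from rot[OF _ this, of ?u] show ?thesis
        by (simp add: uz inner_add_left inner_add_right matrix_vector_right_distrib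
            matrix_vector_mult_scaleR power2_eq_square algebra_simps)
    qed
    from linear_le_quadratic_imp_zero[OF this] show ?thesis by simp
  qed simp
  have "axis i 1 \<bullet> (B *v axis j 1) = B $ i $ j" for i j :: 'n
    by (simp add: matrix_vector_mult_basis inner_axis' column_def)
  with sym show "transpose B = B" by (simp add: transpose_def vec_eq_iff)
qed

text \<open>Take \<open>R\<close> maximising the inner product with \<open>A\<close> over the
  compact set of orthogonal matrices. Since \<open>R ** Q\<close> competes for every orthogonal
  \<open>Q\<close>, the identity is maximal for \<open>transpose R ** A\<close>.\<close>

lemma orthogonal_polar_factor:
  fixes A :: "real^'n^'n"
  obtains R where "orthogonal_matrix R" "psd (transpose R ** A)"
proof -
  let ?O = "{R :: real^'n^'n. orthogonal_matrix R}"
  have "?O \<noteq> {}" using orthogonal_matrix_id by blast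
  moreover have "continuous_on ?O (\<lambda>R. R \<bullet> A)" by (intro continuous_intros)
  ultimately obtain R where R: "orthogonal_matrix R"
    and max: "\<And>Q. orthogonal_matrix Q \<Longrightarrow> Q \<bullet> A \<le> R \<bullet> A"
    using continuous_attains_sup[OF compact_orthogonal_matrices] by (metis mem_Collect_eq)
  have "Q \<bullet> (transpose R ** A) \<le> mat 1 \<bullet> (transpose R ** A)" if "orthogonal_matrix Q" for Q
    using max[OF orthogonal_matrix_mul[OF R that]] inner_matrix_mul_left[of R "mat 1" A]
    by (simp add: inner_matrix_mul_left)
  then show ?thesis using that[OF R] psd_if_trace_maximal by blast
qed

section \<open>Distance between factors in terms of their Gram matrices\<close>

lemma norm_mul_transpose_ge:
  fixes S D :: "real^'r^'n"
  assumes "\<And>x. c * (norm x)\<^sup>2 \<le> (norm (S *v x))\<^sup>2"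
  shows "c * (norm D)\<^sup>2 \<le> (norm (D ** transpose S))\<^sup>2"
proof -
  have row: "(D ** transpose S) $ i = S *v (D $ i)" for i
    by (simp add: vec_eq_iff matrix_matrix_mult_def matrix_vector_mult_def transpose_def mult.commute)
  have sq: "(norm A)\<^sup>2 = (\<Sum>i\<in>UNIV. (norm (A $ i))\<^sup>2)" for A :: "real^'k^'n"
    by (simp add: power2_norm_eq_inner inner_vec_def)
  show ?thesis
    unfolding sq row sum_distrib_left by (intro sum_mono assms)
qed

text \<open>With \<open>D = U - W\<close> and \<open>S = U + W\<close>, twice the Gram difference is
  \<open>D ** transpose S + S ** transpose D\<close>. Symmetry of \<open>transpose W ** U\<close>
  gives the two summands a nonnegative inner product; its positivity lets \<open>S\<close> inherit
  the lower bound of \<open>W\<close>.\<close>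

lemma gram_difference_bound:
  fixes U W :: "real^'r^'n"
  assumes psd: "psd (transpose W ** U)" and W: "\<And>x. c * (norm x)\<^sup>2 \<le> (norm (W *v x))\<^sup>2"
  shows "c * (norm (U - W))\<^sup>2 \<le> 2 * (norm (U ** transpose U - W ** transpose W))\<^sup>2"
proof -
  define D where "D = U - W"
  define S where "S = U + W"
  let ?G = "U ** transpose U - W ** transpose W"
  have WU: "transpose W ** U = transpose U ** W"
    using psd unfolding psd_def by (metis matrix_transpose_mul transpose_transpose)
  have G: "D ** transpose S + S ** transpose D = 2 *\<^sub>R ?G"
    by (simp add: D_def S_def transpose_plus transpose_minus matrix_sub_ldistrib matrix_sub_rdistrib
        matrix_add_ldistrib matrix_add_rdistrib scaleR_2)
  have sym: "transpose S ** D = transpose D ** S"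
    by (simp add: D_def S_def transpose_plus transpose_minus matrix_sub_ldistrib matrix_sub_rdistrib
        matrix_add_ldistrib matrix_add_rdistrib WU)
  have "(D ** transpose S) \<bullet> (S ** transpose D) = transpose S \<bullet> ((transpose D ** S) ** transpose D)"
    by (simp add: inner_matrix_mul_left matrix_mul_assoc)
  also have "\<dots> = (transpose D ** S) \<bullet> (transpose S ** D)"
    using inner_matrix_mul_right[of "transpose D ** S" "transpose D" "transpose S"]
    by (simp add: inner_commute)
  also have "\<dots> = (norm (transpose D ** S))\<^sup>2" by (simp add: sym power2_norm_eq_inner)
  finally have cross: "0 \<le> (D ** transpose S) \<bullet> (S ** transpose D)" by simp
  have eqn: "norm (S ** transpose D) = norm (D ** transpose S)"
    using norm_transpose[of "S ** transpose D"] by (simp add: matrix_transpose_mul)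
  have "4 * (norm ?G)\<^sup>2 = (norm (D ** transpose S + S ** transpose D))\<^sup>2"
    by (simp add: G power_mult_distrib)
  also have "\<dots> = 2 * (norm (D ** transpose S))\<^sup>2 + 2 * ((D ** transpose S) \<bullet> (S ** transpose D))"
    using dot_norm[of "D ** transpose S" "S ** transpose D"] unfolding eqn by (simp add: field_simps)
  finally have "(norm (D ** transpose S))\<^sup>2 \<le> 2 * (norm ?G)\<^sup>2" using cross by simp
  moreover have "c * (norm D)\<^sup>2 \<le> (norm (D ** transpose S))\<^sup>2"
  proof (rule norm_mul_transpose_ge)
    fix x
    have "0 \<le> x \<bullet> ((transpose W ** U) *v x)" using psd by (simp add: psd_def)
    then have "0 \<le> (W *v x) \<bullet> (U *v x)"
      using inner_matrix_vector_mult_swap[of x "transpose W" "U *v x"]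
      by (simp only: matrix_vector_mul_assoc[symmetric] transpose_transpose)
    then have "(norm (W *v x))\<^sup>2 \<le> (norm (S *v x))\<^sup>2"
      unfolding S_def matrix_vector_mult_add_rdistrib power2_norm_eq_inner
      by (simp add: inner_add inner_commute)
    with W[of x] show "c * (norm x)\<^sup>2 \<le> (norm (S *v x))\<^sup>2" by linarith
  qed
  ultimately show ?thesis by (simp add: D_def)
qed

text \<open>For the polar factor \<open>R\<close> of \<open>transpose V ** U\<close>, the matrix
  \<open>V ** R\<close> qualifies as \<open>W\<close> in the Gram bound, and rotation preserves both
  \<open>V ** transpose V\<close> and the lower bound. \<open>R\<close> is one competitor in the
  infimum.\<close>

lemma Dist_le_gram_difference:
  fixes U V :: "real^'r^'n"
  assumes V: "\<And>x. c * (norm x)\<^sup>2 \<le> (norm (V *v x))\<^sup>2" and c: "c > 0"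
  shows "Dist U V \<le> sqrt 2 * norm (U ** transpose U - V ** transpose V) / sqrt c"
proof -
  obtain R where R: "orthogonal_matrix R" and psd: "psd (transpose R ** (transpose V ** U))"
    using orthogonal_polar_factor by blast
  have RR: "transpose R ** R = mat 1" "R ** transpose R = mat 1"
    using R by (simp_all add: orthogonal_matrix_def)
  have "c * (norm (U - V ** R))\<^sup>2
    \<le> 2 * (norm (U ** transpose U - (V ** R) ** transpose (V ** R)))\<^sup>2"
  proof (rule gram_difference_bound)
    show "psd (transpose (V ** R) ** U)" using psd by (simp add: matrix_transpose_mul matrix_mul_assoc)
    fix x
    have "(R *v x) \<bullet> (R *v x) = x \<bullet> x"
      using inner_matrix_vector_mult_swap[of "R *v x" R x]
      by (simp only: matrix_vector_mul_assoc RR matrix_vector_mul_lid)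
    then have "norm (R *v x) = norm x" by (simp add: norm_eq_sqrt_inner)
    then show "c * (norm x)\<^sup>2 \<le> (norm ((V ** R) *v x))\<^sup>2"
      using V[of "R *v x"] by (simp add: matrix_vector_mul_assoc)
  qed
  moreover have "(V ** R) ** transpose (V ** R) = V ** transpose V"
    unfolding matrix_transpose_mul
    by (metis RR(2) matrix_mul_assoc matrix_mul_rid)
  ultimately have "sqrt (c * (norm (U - V ** R))\<^sup>2) \<le> sqrt (2 * (norm (U ** transpose U - V ** transpose V))\<^sup>2)"
    by simp
  then have "norm (U - V ** R) \<le> sqrt 2 * norm (U ** transpose U - V ** transpose V) / sqrt c"
    using c by (simp add: real_sqrt_mult field_simps)
  moreover have "Dist U V \<le> norm (U - V ** R)"
    unfolding Dist_def frob_norm_eq_norm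
    by (rule cInf_lower) (use R in \<open>auto intro!: bdd_belowI[of _ 0]\<close>)
  ultimately show ?thesis by linarith
qed

subsection \<open>Singular values of factors and truncations\<close>

text \<open>The \<open>b i\<close> are right singular vectors of \<open>U\<close>. There are as many
  as \<open>U\<close> has columns, so they form an orthonormal basis and Parseval applies to
  \<open>y\<close>.\<close>

lemma gram_lower_bound:
  fixes U :: "real^'r^'n"
  assumes v: "orthonormal_seq CARD('n) v" and r: "CARD('r) \<le> CARD('n)"
    and U: "U ** transpose U = (\<Sum>i<CARD('r). l i *\<^sub>R outer (v i) (v i))"
    and l: "\<And>i. i < CARD('r) \<Longrightarrow> c \<le> l i" and c: "c > 0"
  shows "c * (norm y)\<^sup>2 \<le> (norm (U *v y))\<^sup>2"
proof -
  let ?r = "CARD('r)"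
  define b where "b i = (1 / sqrt (l i)) *\<^sub>R (transpose U *v v i)" for i
  have l_pos: "0 < l i" if "i < ?r" for i using l[OF that] c by linarith
  have "orthonormal_seq ?r b"
    unfolding orthonormal_seq_def
  proof (intro allI impI)
    fix i j assume ij: "i < ?r" "j < ?r"
    have "(transpose U *v v i) \<bullet> (transpose U *v v j) = v i \<bullet> ((U ** transpose U) *v v j)"
      by (simp only: matrix_vector_mul_assoc[symmetric] inner_matrix_vector_mult_swap[of "v i"])
    also have "\<dots> = (if i = j then l i else 0)"
      using sum_outer_mult_basis[OF v, of "{..<?r}" j l] ij r orthonormal_seqD[OF v, of i j]
      by (auto simp: U)
    finally show "b i \<bullet> b j = (if i = j then 1 else 0)"
      using l_pos[OF ij(1)] by (auto simp: b_def simp del: transpose_matrix_vector)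
  qed
  then have "c * (norm y)\<^sup>2 = (\<Sum>i<?r. c * (b i \<bullet> y)\<^sup>2)"
    by (simp add: orthonormal_seq_parseval[symmetric] sum_distrib_left)
  also have "\<dots> \<le> (\<Sum>i<?r. l i * (b i \<bullet> y)\<^sup>2)"
    by (intro sum_mono mult_right_mono l) auto
  also have "\<dots> = (\<Sum>i<?r. (v i \<bullet> (U *v y))\<^sup>2)"
  proof (intro sum.cong refl)
    fix i assume "i \<in> {..<?r}"
    then have "0 < l i" using l_pos by simp
    then show "l i * (b i \<bullet> y)\<^sup>2 = (v i \<bullet> (U *v y))\<^sup>2"
      by (simp add: b_def inner_matrix_vector_mult_swap[of "v i"] power_divide)
  qed
  also have "\<dots> \<le> (\<Sum>i<CARD('n). (v i \<bullet> (U *v y))\<^sup>2)"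
    using r by (intro sum_mono2) auto
  also have "\<dots> = (norm (U *v y))\<^sup>2" by (rule orthonormal_seq_parseval[OF v])
  finally show ?thesis .
qed

text \<open>The bound on the quadratic form of \<open>transpose U ** U\<close> passes to all its
  eigenvalues. The shift \<open>i - 1\<close> matches singular values counted from 1 with
  eigenvalues counted from 0.\<close>

lemma sing_val_ge:
  fixes U :: "real^'r^'n"
  assumes U: "\<And>y. c * (norm y)\<^sup>2 \<le> (norm (U *v y))\<^sup>2" and i: "i - 1 < CARD('r)"
  shows "sqrt c \<le> sing_val U i"
proof -
  have sym: "transpose (transpose U ** U) = transpose U ** U"
    by (simp add: matrix_transpose_mul)
  obtain v l where vl: "eig_decomp (transpose U ** U) v l" "desc_sorted CARD('r) l"
    using symmetric_eig_decomp_exists[OF sym] by blast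
  have "c \<le> l (i - 1)"
  proof (rule eig_decomp_eigenvalue_ge[OF vl(1) i])
    fix x
    have "x \<bullet> ((transpose U ** U) *v x) = (norm (U *v x))\<^sup>2"
      using inner_matrix_vector_mult_swap[of x "transpose U" "U *v x"]
      by (simp only: matrix_vector_mul_assoc[symmetric] transpose_transpose power2_norm_eq_inner)
    then show "c * (norm x)\<^sup>2 \<le> x \<bullet> ((transpose U ** U) *v x)" using U by simp
  qed
  then show ?thesis unfolding sing_val_def eigval_desc_eq[OF vl i] by simp
qed

text \<open>The squares \<open>(l j)\<^sup>2\<close>, padded by zeros from \<open>r\<close> on, are
  the sorted eigenvalues of \<open>transpose ?T ** ?T\<close>; nonnegativity lets the square root
  return \<open>l\<close>.\<close>

lemma sing_val_truncation:
  fixes v :: "nat \<Rightarrow> real^'n"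
  assumes v: "orthonormal_seq CARD('n) v" and sorted: "desc_sorted CARD('n) l"
    and nonneg: "\<And>i. i < CARD('n) \<Longrightarrow> 0 \<le> l i" and r: "r \<le> CARD('n)" and i: "i - 1 < r"
  shows "sing_val (\<Sum>i<r. l i *\<^sub>R outer (v i) (v i)) i = l (i - 1)"
proof -
  let ?T = "\<Sum>i<r. l i *\<^sub>R outer (v i) (v i)"
  let ?l = "\<lambda>j. if j < r then (l j)\<^sup>2 else 0"
  have "eig_decomp (transpose ?T ** ?T) v ?l"
  proof (rule eig_decompI[OF v])
    fix j assume "j < CARD('n)"
    then have "?T *v v j = (if j < r then l j *\<^sub>R v j else 0)"
      using sum_outer_mult_basis[OF v, of "{..<r}" j l] r by simp
    then show "(transpose ?T ** ?T) *v v j = ?l j *\<^sub>R v j"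
      by (simp add: sum_outer_symmetric matrix_vector_mul_assoc[symmetric] matrix_vector_mult_scaleR power2_eq_square)
  qed
  moreover have "desc_sorted CARD('n) ?l"
    using sorted nonneg r by (auto simp: desc_sorted_def intro!: power_mono)
  ultimately have "eigval_desc (transpose ?T ** ?T) (i - 1) = ?l (i - 1)"
    using r i by (intro eigval_desc_eq) auto
  then show ?thesis using i nonneg[of "i - 1"] r by (simp add: sing_val_def)
qed

section \<open>Rank and positivity of the leading eigenvalues\<close>

lemma rank_sum_outer_le: "rank (\<Sum>i<k. l i *\<^sub>R outer (v i) (v i :: real^'n)) \<le> k"
proof -
  have "range (\<lambda>x. (\<Sum>i<k. l i *\<^sub>R outer (v i) (v i)) *v x) \<subseteq> span (v ` {..<k})"
    by (auto simp: sum_outer_mult_vector intro!: span_sum intro: span_scale span_base)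
  then have "dim (range (\<lambda>x. (\<Sum>i<k. l i *\<^sub>R outer (v i) (v i)) *v x)) \<le> dim (span (v ` {..<k}))"
    by (rule dim_subset)
  then have "rank (\<Sum>i<k. l i *\<^sub>R outer (v i) (v i)) \<le> dim (v ` {..<k})"
    by (simp only: rank_dim_range dim_span)
  also have "\<dots> \<le> card (v ` {..<k})" by (simp add: dim_le_card')
  also have "\<dots> \<le> k" using card_image_le[of "{..<k}" v] by simp
  finally show ?thesis .
qed

text \<open>If \<open>l k\<close> were zero, order and nonnegativity would kill all later
  eigenvalues, leaving \<open>k\<close> rank-one terms and so rank at most \<open>k\<close>.\<close>

lemma eigenvalue_pos_of_rank:
  fixes X :: "real^'n^'n"
  assumes X: "eig_decomp X v l" and sorted: "desc_sorted CARD('n) l"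
    and nonneg: "\<And>i. i < CARD('n) \<Longrightarrow> 0 \<le> l i" and k: "k < rank X"
  shows "0 < l k"
proof (rule ccontr)
  have kn: "k < CARD('n)" using k rank_bound[of X] by simp
  assume "\<not> 0 < l k"
  then have "l i = 0" if "k \<le> i" "i < CARD('n)" for i
    using that sorted nonneg[of i] unfolding desc_sorted_def by (metis leD order_le_less order_trans)
  then have "(\<Sum>i<CARD('n). l i *\<^sub>R outer (v i) (v i)) = (\<Sum>i<k. l i *\<^sub>R outer (v i) (v i))"
    using kn by (intro sum.mono_neutral_right) auto
  then have "X = (\<Sum>i<k. l i *\<^sub>R outer (v i) (v i))"
    using X by (simp add: eig_decomp_iff)
  with k rank_sum_outer_le[of l v k] show False by simp
qed

subsection \<open>The projected gradient at the origin\<close>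

lemma psd_zero: "psd 0"
  by (simp add: psd_def transpose_def vec_eq_iff)

lemma psd_add: "psd A \<Longrightarrow> psd B \<Longrightarrow> psd (A + B)"
  by (simp add: psd_def transpose_plus matrix_vector_mult_add_rdistrib inner_add_right)

lemma psd_scaleR: "0 \<le> c \<Longrightarrow> psd A \<Longrightarrow> psd (c *\<^sub>R A)"
  by (simp add: psd_def transpose_scalar scalar_mult_eq_scaleR scaleR_matrix_vector_assoc[symmetric])

lemma psd_outer: "psd (outer v v)"
  using psd_sum_outer[of "{0}" "\<lambda>_. 1" "\<lambda>_. v"] by simp

lemma norm_outer: "norm (outer u w) = norm u * norm w"
proof -
  have "outer u w \<bullet> outer u w = (norm u * norm w)\<^sup>2"
    by (simp add: inner_outer outer_mult_vector power_mult_distrib power2_norm_eq_inner)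
  then show ?thesis by (simp add: norm_eq_sqrt_inner[of "outer u w"])
qed

lemma psd_eig_nonneg:
  fixes A :: "real^'n^'n"
  assumes "psd A" "eig_decomp A v l" "j < CARD('n)"
  shows "0 \<le> l j"
  by (rule eig_decomp_eigenvalue_ge[OF assms(2,3)]) (use assms(1) in \<open>simp add: psd_def\<close>)

text \<open>\<open>psd_proj Y\<close> acts as \<open>Y\<close> on eigenvectors with positive
  eigenvalue, and \<open>psd_proj Y - Y\<close> is carried by the others with coefficients
  \<open>- l i\<close>, all nonnegative. This is the Moreau decomposition for the cone.\<close>

lemma psd_proj_properties:
  fixes Y :: "real^'n^'n"
  assumes sym: "transpose Y = Y"
  shows psd_psd_proj: "psd (psd_proj Y)"
    and inner_psd_proj: "psd_proj Y \<bullet> Y = (norm (psd_proj Y))\<^sup>2"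
    and inner_psd_proj_ge: "psd Z \<Longrightarrow> Y \<bullet> Z \<le> psd_proj Y \<bullet> Z"
proof -
  let ?S = "\<lambda>l :: nat \<Rightarrow> real. {i. i < CARD('n) \<and> l i > 0}"
  obtain v0 l0 where "eig_decomp Y v0 l0" using symmetric_eig_decomp_exists[OF sym] by blast
  then have "\<exists>v l. eig_decomp Y v l \<and> psd_proj Y = (\<Sum>i\<in>?S l. l i *\<^sub>R outer (v i) (v i))"
    unfolding psd_proj_def
    by (intro someI_ex[of "\<lambda>P. \<exists>v l. eig_decomp Y v l \<and> P = (\<Sum>i\<in>?S l. l i *\<^sub>R outer (v i) (v i))"]) blast
  then obtain v l where Y: "eig_decomp Y v l"
    and P: "psd_proj Y = (\<Sum>i\<in>?S l. l i *\<^sub>R outer (v i) (v i))" by blast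
  have v: "orthonormal_seq CARD('n) v" using Y by (simp add: eig_decomp_iff)
  show "psd (psd_proj Y)" unfolding P by (rule psd_sum_outer) simp
  have "psd_proj Y *v v i = Y *v v i" if "i \<in> ?S l" for i
    unfolding P using that eig_decomp_eigenvector[OF Y, of i] sum_outer_mult_basis[OF v, of "?S l" i l] by auto
  then have "psd_proj Y \<bullet> Y = psd_proj Y \<bullet> psd_proj Y"
    by (subst (1 2) P) (simp add: inner_sum_left inner_outer)
  then show "psd_proj Y \<bullet> Y = (norm (psd_proj Y))\<^sup>2" by (simp add: power2_norm_eq_inner)
  assume Z: "psd Z"
  have "Y = psd_proj Y + (\<Sum>i\<in>{..<CARD('n)} - ?S l. l i *\<^sub>R outer (v i) (v i))"
    unfolding P using Y sum.subset_diff[of "?S l" "{..<CARD('n)}" "\<lambda>i. l i *\<^sub>R outer (v i) (v i)"]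
    by (auto simp: eig_decomp_iff add.commute)
  then have "psd_proj Y - Y = (\<Sum>i\<in>{..<CARD('n)} - ?S l. (- l i) *\<^sub>R outer (v i) (v i))"
    by (simp add: sum_negf algebra_simps)
  then have "0 \<le> (psd_proj Y - Y) \<bullet> Z"
    using inner_sum_outer_nonneg[of "{..<CARD('n)} - ?S l" "\<lambda>i. - l i" Z v] Z by force
  then show "Y \<bullet> Z \<le> psd_proj Y \<bullet> Z" by (simp add: inner_diff_left)
qed

text \<open>The segment from \<open>X\<close> to \<open>Y\<close> stays in the convex cone, so a
  negative slope at \<open>X\<close> would contradict minimality.\<close>

lemma psd_minimizer_first_order:
  fixes f :: "real^'n^'n \<Rightarrow> real"
  assumes deriv: "(f has_derivative (\<lambda>H. G \<bullet> H)) (at X)" and X: "psd X"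
    and min: "\<And>Y. psd Y \<Longrightarrow> f X \<le> f Y" and Y: "psd Y"
  shows "G \<bullet> X \<le> G \<bullet> Y"
proof (rule ccontr)
  assume "\<not> ?thesis"
  then have neg: "G \<bullet> (Y - X) < 0" by (simp add: inner_diff_right)
  define g where "g t = f (X + t *\<^sub>R (Y - X))" for t :: real
  have "((\<lambda>t::real. X + t *\<^sub>R (Y - X)) has_derivative (\<lambda>t. t *\<^sub>R (Y - X))) (at 0)"
    by (auto intro!: derivative_eq_intros)
  from has_derivative_compose[OF this, of f "\<lambda>H. G \<bullet> H"] deriv
  have "(g has_derivative (\<lambda>t. G \<bullet> (t *\<^sub>R (Y - X)))) (at 0)"
    by (simp add: g_def[abs_def])
  then have "(g has_real_derivative G \<bullet> (Y - X)) (at 0)"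
    by (simp add: has_field_derivative_def mult_commute_abs)
  from DERIV_neg_dec_right[OF this neg] obtain d where "d > 0"
    and d: "\<And>h. 0 < h \<Longrightarrow> h < d \<Longrightarrow> g h < g 0" by auto
  \<comment> \<open>Below \<open>d\<close> there is descent; the cap at 1 keeps the point a convex
    combination.\<close>
  define h where "h = min (d / 2) 1"
  have h: "0 < h" "h < d" "h \<le> 1" using \<open>d > 0\<close> by (auto simp: h_def)
  have "X + h *\<^sub>R (Y - X) = (1 - h) *\<^sub>R X + h *\<^sub>R Y" by (simp add: algebra_simps)
  then have "psd (X + h *\<^sub>R (Y - X))" using h X Y by (simp add: psd_add psd_scaleR)
  from min[OF this] d[OF h(1,2)] show False by (simp add: g_def)
qed

text \<open>Transposition is linear and self-adjoint, so differentiating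
  \<open>f (transpose X)\<close> at 0 gives a second expression for the same derivative. Symmetry is
  what gives \<open>- gf 0\<close> an eigendecomposition to project.\<close>

lemma symmetric_gradient:
  fixes f :: "real^'n^'n \<Rightarrow> real"
  assumes deriv: "(f has_derivative (\<lambda>H. G \<bullet> H)) (at 0)" and symm: "\<And>X. f X = f (transpose X)"
  shows "transpose G = G"
proof -
  have bl: "bounded_linear (transpose :: real^'n^'n \<Rightarrow> real^'n^'n)"
    by (intro linear_conv_bounded_linear[THEN iffD1] linearI)
       (simp_all add: transpose_plus transpose_scalar scalar_mult_eq_scaleR)
  have "transpose (0 :: real^'n^'n) = 0" by (simp add: transpose_def vec_eq_iff)
  then have "((\<lambda>X. f (transpose X)) has_derivative (\<lambda>H. G \<bullet> transpose H)) (at 0)"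
    using has_derivative_compose[OF bounded_linear_imp_has_derivative[OF bl], of f "\<lambda>H. G \<bullet> H" 0 UNIV] deriv
    by simp
  then have "(\<lambda>H. G \<bullet> transpose H) = (\<lambda>H. G \<bullet> H)"
    using has_derivative_unique[OF deriv] symm by (metis (no_types, lifting) ext)
  then have "transpose G \<bullet> H = G \<bullet> H" for H
    using inner_transpose[of "transpose G" H] by (metis transpose_transpose)
  then show ?thesis by (metis vector_eq_rdot)
qed

text \<open>Expand the square: \<open>m \<le> L\<close> controls the norm term and yields
  \<open>(M/m)\<^sup>2\<close>, while \<open>L \<le> M\<close> controls the inner product and yields
  \<open>2 / (M/m)\<close>.\<close>

lemma scaled_projection_estimate:
  fixes P X :: "'a::real_inner"
  assumes m: "0 < m" and L: "m \<le> L" "L \<le> M"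
    and P: "norm P \<le> M * norm X" and PX: "m * (norm X)\<^sup>2 \<le> P \<bullet> X"
  shows "norm ((1 / L) *\<^sub>R P - X) \<le> sqrt ((M/m)\<^sup>2 - 2 / (M/m) + 1) * norm X"
proof -
  have pos: "0 < L" "0 < M" using m L by auto
  have "norm ((1 / L) *\<^sub>R P) = norm P / L" using pos by simp
  also have "\<dots> \<le> (M * norm X) / m"
    using m L P pos by (intro frac_le) auto
  finally have nP: "(norm ((1 / L) *\<^sub>R P))\<^sup>2 \<le> (M / m)\<^sup>2 * (norm X)\<^sup>2"
    by (simp add: power_mult_distrib[symmetric] power_mono)
  have "m / M * (norm X)\<^sup>2 \<le> m * (norm X)\<^sup>2 / L"
    using m L pos by (simp add: frac_le)
  also have "\<dots> \<le> (P \<bullet> X) / L"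
    using PX pos by (simp add: divide_right_mono)
  finally have iPX: "m / M * (norm X)\<^sup>2 \<le> ((1 / L) *\<^sub>R P) \<bullet> X" by simp
  have "(norm ((1 / L) *\<^sub>R P - X))\<^sup>2
      = (norm ((1 / L) *\<^sub>R P))\<^sup>2 + (norm X)\<^sup>2 - 2 * (((1 / L) *\<^sub>R P) \<bullet> X)"
    using dot_norm_neg[of "(1 / L) *\<^sub>R P" X] by (simp add: field_simps)
  also have "\<dots> \<le> (M / m)\<^sup>2 * (norm X)\<^sup>2 + (norm X)\<^sup>2 - 2 * (m / M * (norm X)\<^sup>2)"
    using nP iPX by linarith
  also have "\<dots> = ((M/m)\<^sup>2 - 2 / (M/m) + 1) * (norm X)\<^sup>2"
    by (simp add: algebra_simps)
  finally have "norm ((1 / L) *\<^sub>R P - X) \<le> sqrt (((M/m)\<^sup>2 - 2 / (M/m) + 1) * (norm X)\<^sup>2)"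
    by (rule real_le_rsqrt)
  then show ?thesis by (simp add: real_sqrt_mult)
qed

theorem initial_point_estimate:
  fixes f :: "real^'n^'n \<Rightarrow> real" and gf :: "real^'n^'n \<Rightarrow> real^'n^'n"
  assumes grad: "\<And>X. (f has_derivative (\<lambda>H. gf X \<bullet> H)) (at X)"
    and symm: "\<And>X. f X = f (transpose X)"
    and smooth: "\<And>X Y. psd X \<Longrightarrow> psd Y \<Longrightarrow> norm (gf X - gf Y) \<le> M * norm (X - Y)"
    and strong: "\<And>X Y. psd X \<Longrightarrow> psd Y \<Longrightarrow>
        f Y \<ge> f X + gf X \<bullet> (Y - X) + m / 2 * (norm (Y - X))\<^sup>2"
    and m: "m > 0" and X: "psd X" and min: "\<And>Y. psd Y \<Longrightarrow> f X \<le> f Y"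
    and e: "norm e = 1"
  shows "norm ((1 / norm (gf 0 - gf (outer e e))) *\<^sub>R psd_proj (- gf 0) - X)
    \<le> sqrt ((M/m)\<^sup>2 - 2 / (M/m) + 1) * norm X"
proof (rule scaled_projection_estimate[OF m])
  let ?P = "psd_proj (- gf 0)" and ?E = "outer e e"
  \<comment> \<open>Strong convexity between 0 and \<open>Y\<close> is added in both directions; the
    two halves \<open>m / 2\<close> make \<open>m\<close>.\<close>
  have mono: "m * (norm Y)\<^sup>2 \<le> (gf Y - gf 0) \<bullet> Y" if "psd Y" for Y
    using strong[OF psd_zero that] strong[OF that psd_zero]
    by (simp add: inner_diff_left)
  \<comment> \<open>Since \<open>?E\<close> has unit norm, \<open>m\<close> and \<open>M\<close>
    themselves bound the gradient difference.\<close>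
  have E: "psd ?E" "norm ?E = 1" by (simp_all add: psd_outer norm_outer e)
  have "m \<le> (gf ?E - gf 0) \<bullet> ?E" using mono[OF E(1)] E(2) by simp
  also have "\<dots> \<le> norm (gf ?E - gf 0)" using norm_cauchy_schwarz[of "gf ?E - gf 0" ?E] E(2) by simp
  finally show "m \<le> norm (gf 0 - gf ?E)" by (simp add: norm_minus_commute)
  show "norm (gf 0 - gf ?E) \<le> M" using smooth[OF psd_zero E(1)] E(2) by simp
  have sym: "transpose (- gf 0) = - gf 0"
    using symmetric_gradient[OF grad symm] by (simp add: transpose_uminus)
  have opt: "gf X \<bullet> X \<le> gf X \<bullet> Y" if "psd Y" for Y
    using psd_minimizer_first_order[OF grad X min that] .
  have "m * (norm X)\<^sup>2 \<le> (gf X - gf 0) \<bullet> X" by (rule mono[OF X])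
  also have "\<dots> \<le> (- gf 0) \<bullet> X" using opt[OF psd_zero] by (simp add: inner_diff_left)
  also have "\<dots> \<le> ?P \<bullet> X" by (rule inner_psd_proj_ge[OF sym X])
  finally show "m * (norm X)\<^sup>2 \<le> ?P \<bullet> X" .
  have "(norm ?P)\<^sup>2 = (gf X - gf 0) \<bullet> ?P - gf X \<bullet> ?P"
    using inner_psd_proj[OF sym] by (simp add: inner_diff_left inner_commute[of ?P])
  \<comment> \<open>Testing optimality at \<open>X + ?P\<close> gives
    \<open>0 \<le> gf X \<bullet> ?P\<close>.\<close>
  also have "\<dots> \<le> (gf X - gf 0) \<bullet> ?P"
    using opt[OF psd_add[OF X psd_psd_proj[OF sym]]] by (simp add: inner_add_right)
  also have "\<dots> \<le> norm (gf X - gf 0) * norm ?P" by (rule norm_cauchy_schwarz)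
  also have "\<dots> \<le> (M * norm X) * norm ?P"
    using smooth[OF X psd_zero] by (intro mult_right_mono) auto
  finally have "norm ?P * norm ?P \<le> (M * norm X) * norm ?P" by (simp add: power2_eq_square)
  moreover have "0 \<le> M * norm X" using order_trans[OF norm_ge_zero smooth[OF X psd_zero]] by simp
  ultimately show "norm ?P \<le> M * norm X" by (cases "?P = 0") simp_all
qed

subsection \<open>Quality of the initial factor\<close>

theorem theorem5p2:
  fixes f :: "real^'n::{finite,wellorder}^'n::{finite,wellorder} \<Rightarrow> real"
    and gf :: "real^'n::{finite,wellorder}^'n::{finite,wellorder} \<Rightarrow> real^'n::{finite,wellorder}^'n::{finite,wellorder}"
    and M m \<rho> :: real
    and Xs Xsr X0r :: "real^'n::{finite,wellorder}^'n::{finite,wellorder}"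
    and Usr U0 :: "real^'r::finite^'n::{finite,wellorder}"
  assumes convex: "convex_on UNIV f"
    and grad: "\<And>X. (f has_derivative (\<lambda>H. frob_inner (gf X) H)) (at X)"
    and symm: "\<And>X. f X = f (transpose X)"
    and smooth: "\<And>X Y. psd X \<Longrightarrow> psd Y \<Longrightarrow> frob_norm (gf X - gf Y) \<le> M * frob_norm (X - Y)"
    and strong: "\<And>X Y. psd X \<Longrightarrow> psd Y \<Longrightarrow>
        f Y \<ge> f X + frob_inner (gf X) (Y - X) + m / 2 * (frob_norm (Y - X))^2"
    and m_pos: "m > 0"
    and Xs_psd: "psd Xs"
    and Xs_min: "\<And>Y. psd Y \<Longrightarrow> f Xs \<le> f Y"
    and r_le: "CARD('r) \<le> rank Xs"
    and Xsr: "best_rank_approx CARD('r) Xs Xsr"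
    and Usr: "Usr ** transpose Usr = Xsr"
    and X0r: "best_rank_approx CARD('r)
               ((1 / frob_norm (gf 0 - gf (outer e1 e1))) *\<^sub>R psd_proj (- gf 0)) X0r"
    and U0: "U0 ** transpose U0 = X0r"
    and rho_nn: "\<rho> \<ge> 0"
    and tail: "frob_norm (Xs - Xsr) \<le> \<rho> * spec_norm Xsr"
  shows "Dist U0 Usr \<le>
    4 * tau CARD('r) Xsr * sqrt (2 * real CARD('r)) *
      (sqrt ((M/m)^2 - 2 / (M/m) + 1) * (sqrt (srank Xsr) + \<rho>) + \<rho>)
    * sing_val Usr CARD('r)"
proof -
  note frob = frob_inner_eq_inner frob_norm_eq_norm
  let ?r = "CARD('r)" and ?n = "CARD('n)"
  define X0 where "X0 = (1 / norm (gf 0 - gf (outer e1 e1))) *\<^sub>R psd_proj (- gf 0)"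
  define K where "K = sqrt ((M/m)\<^sup>2 - 2 / (M/m) + 1)"
  have r_pos: "0 < ?r" by simp
  have rn: "?r \<le> ?n" using r_le rank_bound[of Xs] by simp

  obtain w \<mu> where w\<mu>: "eig_decomp Xs w \<mu>" "desc_sorted ?n \<mu>"
    and Xsr_eq: "Xsr = (\<Sum>i<?r. \<mu> i *\<^sub>R outer (w i) (w i))"
    using Xsr unfolding best_rank_approx_def by blast
  have w: "orthonormal_seq ?n w" using w\<mu>(1) by (simp add: eig_decomp_iff)
  have \<mu>_nn: "0 \<le> \<mu> i" if "i < ?n" for i using psd_eig_nonneg[OF Xs_psd w\<mu>(1) that] .
  define s1 where "s1 = \<mu> 0"
  \<comment> \<open>Eigenvalues are counted from 0, so this is the last one kept by the
    truncation.\<close>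
  define sr where "sr = \<mu> (?r - 1)"
  have sr: "sr > 0"
    unfolding sr_def
    by (rule eigenvalue_pos_of_rank[OF w\<mu>])
       (use \<mu>_nn less_le_trans[OF diff_less[OF zero_less_one r_pos] r_le] in auto)
  have sr_le: "sr \<le> \<mu> i" if "i < ?r" for i
    using w\<mu>(2) that rn unfolding sr_def desc_sorted_def by auto
  have s1: "s1 > 0" using sr_le[OF r_pos] sr by (simp add: s1_def)
  have sing: "sing_val Xsr 1 = s1" "sing_val Xsr ?r = sr"
    unfolding Xsr_eq s1_def sr_def
    using sing_val_truncation[OF w w\<mu>(2) \<mu>_nn rn] r_pos by auto
  have spec: "spec_norm Xsr = s1" by (simp only: spec_norm_def sing)
  have tau: "tau ?r Xsr = s1 / sr" by (simp only: tau_def sing)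
  have srank: "sqrt (srank Xsr) * s1 = norm Xsr"
    using s1 by (simp add: srank_def frob spec real_sqrt_divide)

  have e1: "norm (e1 :: real^'n::{finite,wellorder}) = 1" by (simp add: e1_def)
  have est: "norm (X0 - Xs) \<le> K * norm Xs"
    unfolding X0_def K_def
    by (rule initial_point_estimate[OF grad[unfolded frob] symm smooth[unfolded frob]
          strong[unfolded frob] m_pos Xs_psd Xs_min e1])
  have "norm Xs \<le> norm Xsr + norm (Xs - Xsr)" by (metis norm_triangle_sub)
  then have Xs_le: "norm Xs \<le> (sqrt (srank Xsr) + \<rho>) * s1"
    using tail by (simp add: frob spec distrib_right srank)
  \<comment> \<open>The sign of \<open>K\<close> is read off from \<open>est\<close>: its left side
    is nonnegative, and \<open>Xs\<close> is nonzero because its rank is positive.\<close>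
  have K: "0 \<le> K"
  proof -
    have "Xs \<noteq> 0" using r_le r_pos by (auto simp: rank_eq_0)
    then show ?thesis using order_trans[OF norm_ge_zero est] by (simp add: zero_le_mult_iff)
  qed
  define \<delta> where "\<delta> = K * (sqrt (srank Xsr) + \<rho>) + \<rho>"
  have "norm (X0 - Xsr) \<le> norm (X0 - Xs) + norm (Xs - Xsr)"
    using norm_triangle_ineq[of "X0 - Xs" "Xs - Xsr"] by simp
  also have "\<dots> \<le> K * ((sqrt (srank Xsr) + \<rho>) * s1) + \<rho> * s1"
    using est mult_left_mono[OF Xs_le K] tail by (simp add: frob spec)
  finally have X0_Xsr: "norm (X0 - Xsr) \<le> \<delta> * s1" by (simp add: \<delta>_def algebra_simps)
  then have \<delta>: "0 \<le> \<delta>" using s1 order_trans[OF norm_ge_zero] by (metis zero_le_mult_iff not_less)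

  have "transpose (- gf 0) = - gf 0"
    using symmetric_gradient[OF grad[unfolded frob] symm] by (simp add: transpose_uminus)
  then have X0_psd: "psd X0"
    unfolding X0_def by (intro psd_scaleR psd_psd_proj) auto
  obtain v l where vl: "eig_decomp X0 v l" "desc_sorted ?n l"
    and X0r_eq: "X0r = (\<Sum>i<?r. l i *\<^sub>R outer (v i) (v i))"
    using X0r unfolding best_rank_approx_def frob X0_def by blast
  \<comment> \<open>\<open>Xsr\<close> is an admissible competitor for \<open>X0\<close>, since it
    kills every \<open>w j\<close> from index \<open>?r\<close> on.\<close>
  have "norm (X0 - X0r) \<le> norm (X0 - Xsr)"
    unfolding X0r_eq
    by (rule truncation_best_approximation[OF vl psd_eig_nonneg[OF X0_psd vl(1)] rn w])
       (use rn in \<open>auto simp: Xsr_eq sum_outer_mult_basis[OF w]\<close>)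
  then have X0r_Xsr: "norm (X0r - Xsr) \<le> 2 * (\<delta> * s1)"
    using X0_Xsr norm_triangle_ineq4[of "X0 - Xsr" "X0 - X0r"] by simp

  have Usr_ge: "sr * (norm y)\<^sup>2 \<le> (norm (Usr *v y))\<^sup>2" for y
    by (rule gram_lower_bound[OF w rn _ sr_le sr]) (use Usr Xsr_eq in auto)
  have "Dist U0 Usr \<le> sqrt 2 * norm (X0r - Xsr) / sqrt sr"
    using Dist_le_gram_difference[OF Usr_ge sr, of U0] by (simp add: U0 Usr)
  also have "\<dots> \<le> sqrt 2 * (2 * (\<delta> * s1)) / sqrt sr"
    using X0r_Xsr sr by (intro divide_right_mono mult_left_mono) auto
  \<comment> \<open>Writing \<open>s1 / sqrt sr\<close> as \<open>(s1 / sr) * sqrt sr\<close>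
    exposes \<open>tau\<close> and a lower bound for \<open>sing_val Usr ?r\<close>.\<close>
  also have "\<dots> = 2 * (s1 / sr) * sqrt 2 * \<delta> * sqrt sr"
    using sr by (simp add: field_simps)
  \<comment> \<open>Factors are compared one by one: \<open>2 \<le> 4\<close>,
    \<open>sqrt 2 \<le> sqrt (2 * real ?r)\<close> and
    \<open>sqrt sr \<le> sing_val Usr ?r\<close>.\<close>
  also have "\<dots> \<le> 4 * (s1 / sr) * sqrt (2 * real ?r) * \<delta> * sing_val Usr ?r"
    using s1 sr \<delta> sing_val_ge[OF Usr_ge, of ?r] r_pos
    by (intro mult_mono) auto
  finally show ?thesis by (simp add: tau \<delta>_def K_def)
qed

end
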